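(* Let $G=(V,E)$ be a graph with $|V|=n$. Then $$\vartheta(G)=z^{\mathcal{E}}_{0}(G)=z^{\mathcal{E}}_{1}(G)\geqslant z^{\mathcal{E}}_{k-1}(G)\geqslant z^{\mathcal{E}}_{k}(G)\geqslant z^{\mathcal{E}}_{n}(G)=\alpha(G)$$ holds for all $k\in\{1,\dots,n\}$.
   Context: Graphs are finite, simple and undirected, with vertex set $V=\{1,\dots,n\}$, $n\geqslant 1$. $\alpha(G)$ is the stability number (maximum cardinality of a set of pairwise non-adjacent vertices). $\mathcal{S}_n$ denotes the set of real symmetric $n\times n$ matrices, $\mathbf{1}_n$ the all-ones vector, $\operatorname{diag}(X)$ the vector of main-diagonal entries of $X$, and $X\succcurlyeq 0$ means positive semidefinite. For a graph $H$, the set of stable set vectors is $\mathcal{S}(H)=\{s\in\{0,1\}^{V(H)} : s_is_j=0 \text{ for all } \{i,j\}\in E(H)\}$, and the squared stable set polytope is $\operatorname{STAB}^2(H)=\operatorname{conv}\{ss^T : s\in\mathcal{S}(H)\}$. For $I\subseteq V$, $G_I$ is the subgraph of $G$ induced by $I$, and for an $n\times n$ matrix $X$, $X_I=(X_{i,j})_{i,j\in I}$. For $I=\emptyset$ the constraint $X_I\in\operatorname{STAB}^2(G_I)$ is vacuous. Define $$\operatorname{TH}^2(G)=\{(x,X)\in\mathbb{R}^n\times\mathcal{S}_n : \operatorname{diag}(X)=x,\ X_{i,j}=0\ \forall\{i,j\}\in E,\ X-xx^T\succcurlyeq 0\}.$$ The Lovász theta function is $\vartheta(G)=\max\{\mathbf{1}_n^Tx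 : (x,X)\in\operatorname{TH}^2(G)\}$. For an integer $0\leqslant k\leqslant n$, the $k$-th level of the exact subgraph hierarchy is $$z^{\mathcal{E}}_{k}(G)=\max\{\mathbf{1}_n^Tx : (x,X)\in\operatorname{TH}^2(G),\ X_I\in\operatorname{STAB}^2(G_I)\ \forall I\subseteq V \text{ with } |I|=k\}.$$ *)

theory Defs
  imports "HOL-Analysis.Analysis"
begin

record 'a graph =
  verts :: "'a set"
  edges :: "'a set set"

definition simple_graph :: "'a graph \<Rightarrow> bool" where
  "simple_graph G \<longleftrightarrow> finite (verts G) \<and> (\<forall>e\<in>edges G. e \<subseteq> verts G \<and> card e = 2)"

definition induced_subgraph :: "'a graph \<Rightarrow> 'a set \<Rightarrow> 'a graph" where
  "induced_subgraph G I = \<lparr>verts = I, edges = {e \<in> edges G. e \<subseteq> I}\<rparr>"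

definition stable_set :: "'a graph \<Rightarrow> 'a set \<Rightarrow> bool" where
  "stable_set G S \<longleftrightarrow> S \<subseteq> verts G \<and> (\<forall>i\<in>S. \<forall>j\<in>S. {i, j} \<notin> edges G)"

definition stability_number :: "'a graph \<Rightarrow> nat" where
  "stability_number G = Max (card ` {S. stable_set G S})"

definition diag_vec :: "real^'n^'n \<Rightarrow> real^'n" where
  "diag_vec X = (\<chi> i. X $ i $ i)"

definition outer_prod :: "real^'n \<Rightarrow> real^'n \<Rightarrow> real^'n^'n" where
  "outer_prod x y = (\<chi> i j. x $ i * y $ j)"

definition psd :: "real^'n^'n \<Rightarrow> bool" where
  "psd A \<longleftrightarrow> transpose A = A \<and> (\<forall>v. 0 \<le> v \<bullet> (A *v v))"

text \<open>
  For a graph \<open>H\<close> with vertices in the finite type \<open>'n\<close>, vectors and matrices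
  indexed by \<open>verts H\<close> are embedded into \<open>real^'n\<close> and \<open>real^'n^'n\<close> by padding with
  zeros outside \<open>verts H\<close>. This embedding is linear and injective, so it commutes with taking
  convex hulls.
\<close>

definition stable_set_vectors :: "'n graph \<Rightarrow> (real^'n) set" where
  "stable_set_vectors H =
    {s. (\<forall>i\<in>verts H. s $ i \<in> {0, 1}) \<and> (\<forall>i. i \<notin> verts H \<longrightarrow> s $ i = 0) \<and>
        (\<forall>i j. {i, j} \<in> edges H \<longrightarrow> s $ i * s $ j = 0)}"

definition STAB2 :: "'n::finite graph \<Rightarrow> (real^'n^'n) set" where
  "STAB2 H = convex hull {outer_prod s s | s. s \<in> stable_set_vectors H}"

definition principal_submatrix :: "real^'n^'n \<Rightarrow> 'n set \<Rightarrow> real^'n^'n" where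
  "principal_submatrix X I = (\<chi> i j. if i \<in> I \<and> j \<in> I then X $ i $ j else 0)"

text \<open>
  From here on the graphs \<open>G\<close> are meant to have \<open>verts G = UNIV\<close>, so that the number of
  vertices is \<open>CARD('n)\<close>.
\<close>

definition TH2 :: "'n::finite graph \<Rightarrow> ((real^'n) \<times> (real^'n^'n)) set" where
  "TH2 G = {(x, X). transpose X = X \<and> diag_vec X = x \<and>
     (\<forall>i j. {i, j} \<in> edges G \<longrightarrow> X $ i $ j = 0) \<and> psd (X - outer_prod x x)}"

text \<open>
  The exact subgraph constraints for all \<open>I\<close> with \<open>k\<close> elements. For \<open>k = 0\<close> the only constraint
  reads \<open>0 \<in> {0}\<close> in the zero-padded encoding, i.e. it is vacuous.
\<close>

definition exact_feasible :: "nat \<Rightarrow> 'n::finite graph \<Rightarrow> ((real^'n) \<times> (real^'n^'n)) set" where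
  "exact_feasible k G = {(x, X). (x, X) \<in> TH2 G \<and>
     (\<forall>I. I \<subseteq> verts G \<and> card I = k \<longrightarrow>
        principal_submatrix X I \<in> STAB2 (induced_subgraph G I))}"

text \<open>
  \<open>GREATEST\<close> is the maximum, not the supremum; the lemmas at the end of this theory show that
  both maxima are attained. In \<open>1 \<bullet> x\<close>, \<open>1\<close> is the all-ones vector.
\<close>

definition theta :: "'n::finite graph \<Rightarrow> real" where
  "theta G = (GREATEST t. \<exists>x X. (x, X) \<in> TH2 G \<and> t = 1 \<bullet> x)"

definition z_exact :: "nat \<Rightarrow> 'n::finite graph \<Rightarrow> real" where
  "z_exact k G = (GREATEST t. \<exists>x X. (x, X) \<in> exact_feasible k G \<and> t = 1 \<bullet> x)"


lemma finite_stable_set_vectors: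
  "finite (stable_set_vectors (H :: 'n::finite graph))"
proof (rule finite_subset)
  show "stable_set_vectors H \<subseteq> (\<lambda>S. \<chi> i. if i \<in> S then 1 else 0) ` (UNIV :: 'n set set)"
  proof
    fix s assume s: "s \<in> stable_set_vectors H"
    have "s $ i = 0 \<or> s $ i = 1" for i
      using s by (cases "i \<in> verts H") (auto simp: stable_set_vectors_def)
    then have "s = (\<chi> i. if i \<in> {i. s $ i = 1} then 1 else 0)"
      by (auto simp: vec_eq_iff)
    then show "s \<in> (\<lambda>S. \<chi> i. if i \<in> S then 1 else 0) ` (UNIV :: 'n set set)"
      by blast
  qed
qed simp

lemma compact_STAB2: "compact (STAB2 H)"
proof -
  have "finite {outer_prod s s | s. s \<in> stable_set_vectors H}"
    using finite_stable_set_vectors[of H] by simp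
  then show ?thesis
    unfolding STAB2_def by (rule finite_imp_compact_convex_hull)
qed

lemma psd_entry_bound:
  assumes "psd A"
  shows "0 \<le> A $ i $ i" and "2 * \<bar>A $ i $ j\<bar> \<le> A $ i $ i + A $ j $ j"
proof -
  have "transpose A $ j $ i = A $ j $ i" for i j
    using assms by (simp add: psd_def)
  then have sym: "A $ i $ j = A $ j $ i" for i j
    by (simp add: transpose_def)
  have ent: "axis a 1 \<bullet> (A *v axis b 1) = A $ a $ b" for a b
    by (simp add: inner_axis' matrix_vector_mul_component inner_axis)
  have q: "0 \<le> v \<bullet> (A *v v)" for v
    using assms by (simp add: psd_def)
  show "0 \<le> A $ i $ i"
    using q[of "axis i 1"] by (simp add: ent)
  have "0 \<le> A $ i $ i + 2 * A $ i $ j + A $ j $ j"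
    using q[of "axis i 1 + axis j 1"] sym[of i j]
    by (simp add: matrix_vector_right_distrib inner_add_left inner_add_right ent)
  moreover have "0 \<le> A $ i $ i - 2 * A $ i $ j + A $ j $ j"
    using q[of "axis i 1 - axis j 1"] sym[of i j]
    by (simp add: matrix_vector_mult_diff_distrib inner_diff_left inner_diff_right ent)
  ultimately show "2 * \<bar>A $ i $ j\<bar> \<le> A $ i $ i + A $ j $ j"
    by linarith
qed

lemma TH2_entry_bounds:
  assumes "(x, X) \<in> TH2 G"
  shows "\<bar>x $ i\<bar> \<le> 1" and "\<bar>X $ i $ j\<bar> \<le> 2"
proof -
  let ?A = "X - outer_prod x x"
  have psd: "psd ?A" and dg: "\<And>i. X $ i $ i = x $ i"
    using assms by (auto simp: TH2_def diag_vec_def)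
  have A: "?A $ i $ j = X $ i $ j - x $ i * x $ j" for i j
    by (simp add: outer_prod_def)
  have sq: "x $ i * x $ i \<le> x $ i" for i
    using psd_entry_bound(1)[OF psd, of i] unfolding A dg by simp
  have x0: "0 \<le> x $ i" for i
    using sq[of i] zero_le_square[of "x $ i"] by linarith
  have x1: "x $ i \<le> 1" for i
    using sq[of i] x0[of i] by (cases "x $ i = 0") auto
  have le1: "x $ i - x $ i * x $ i \<le> 1" for i
    using diff_mono[OF x1[of i] zero_le_square[of "x $ i"]] by simp
  show "\<bar>x $ i\<bar> \<le> 1"
    using x0 x1 by simp
  have "2 * \<bar>X $ i $ j - x $ i * x $ j\<bar> \<le> (x $ i - x $ i * x $ i) + (x $ j - x $ j * x $ j)"
    using psd_entry_bound(2)[OF psd, of i j] unfolding A dg .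
  also have "\<dots> \<le> 1 + 1"
    by (intro add_mono le1)
  finally have "\<bar>X $ i $ j - x $ i * x $ j\<bar> \<le> 1"
    by simp
  moreover have "0 \<le> x $ i * x $ j" "x $ i * x $ j \<le> 1"
    using x0 x1 by (auto intro: mult_le_one)
  ultimately show "\<bar>X $ i $ j\<bar> \<le> 2"
    unfolding abs_le_iff by linarith
qed

lemma closed_TH2: "closed (TH2 G)"
proof -
  have "TH2 G = {p. transpose (snd p) = snd p} \<inter> {p. diag_vec (snd p) = fst p} \<inter>
      (\<Inter>i. \<Inter>j\<in>{j. {i, j} \<in> edges G}. {p. snd p $ i $ j = 0}) \<inter>
      {p. transpose (snd p - outer_prod (fst p) (fst p)) = snd p - outer_prod (fst p) (fst p)} \<inter>
      (\<Inter>v. {p. 0 \<le> v \<bullet> ((snd p - outer_prod (fst p) (fst p)) *v v)})"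
    by (auto simp: TH2_def psd_def)
  also have "closed \<dots>"
    unfolding transpose_def diag_vec_def outer_prod_def matrix_vector_mult_def
    by (intro closed_Int closed_INT ballI closed_Collect_eq closed_Collect_le continuous_intros)
  finally show ?thesis .
qed

lemma compact_TH2: "compact (TH2 G)"
proof -
  have "bounded (TH2 G)"
  proof (rule boundedI)
    fix p assume p: "p \<in> TH2 G"
    obtain x X where [simp]: "p = (x, X)" by (cases p)
    note bd = TH2_entry_bounds[OF p[simplified]]
    have "norm x \<le> (\<Sum>i\<in>(UNIV :: 'a set). 1)"
      by (rule order_trans[OF norm_le_l1_cart]) (intro sum_mono bd(1))
    moreover have "norm (X $ i) \<le> (\<Sum>i\<in>(UNIV :: 'a set). 2)" for i
      by (rule order_trans[OF norm_le_l1_cart]) (intro sum_mono bd(2))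
    then have "norm X \<le> (\<Sum>i\<in>(UNIV :: 'a set). \<Sum>i\<in>(UNIV :: 'a set). 2)"
      unfolding norm_vec_def[of X] by (intro order_trans[OF L2_set_le_sum] sum_mono norm_ge_zero)
    ultimately show "norm p \<le> (\<Sum>i\<in>(UNIV :: 'a set). 1)
        + (\<Sum>i\<in>(UNIV :: 'a set). \<Sum>i\<in>(UNIV :: 'a set). 2)"
      using norm_Pair_le[of x X] by simp
  qed
  then show ?thesis
    using closed_TH2 by (simp add: compact_eq_bounded_closed)
qed

lemma compact_exact_feasible: "compact (exact_feasible k G)"
proof -
  have "exact_feasible k G = TH2 G \<inter> (\<Inter>I\<in>{I. I \<subseteq> verts G \<and> card I = k}.
      (\<lambda>p. principal_submatrix (snd p) I) -` STAB2 (induced_subgraph G I))"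
    by (auto simp: exact_feasible_def)
  also have "compact \<dots>"
  proof (intro compact_Int_closed compact_TH2 closed_INT ballI continuous_closed_vimage)
    fix I and p :: "(real^'a) \<times> (real^'a^'a)"
    show "closed (STAB2 (induced_subgraph G I))"
      by (rule compact_imp_closed[OF compact_STAB2])
    have "continuous_on UNIV (\<lambda>p :: (real^'a) \<times> (real^'a^'a). if i \<in> I \<and> j \<in> I then snd p $ i $ j else 0)"
      for i j
      by (cases "i \<in> I"; cases "j \<in> I"; simp; intro continuous_intros)
    then have "continuous_on UNIV (\<lambda>p :: (real^'a) \<times> (real^'a^'a). principal_submatrix (snd p) I)"
      unfolding principal_submatrix_def by (intro continuous_on_vec_lambda)
    then show "isCont (\<lambda>p. principal_submatrix (snd p) I) p"
      by (rule continuous_on_interior) simp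
  qed
  finally show ?thesis .
qed

lemma zero_in_exact_feasible: "(0, 0) \<in> exact_feasible k G"
proof -
  have "principal_submatrix 0 I = outer_prod (0 :: real^'a) 0" for I
    by (simp add: principal_submatrix_def outer_prod_def vec_eq_iff)
  moreover have "0 \<in> stable_set_vectors H" for H :: "'a graph"
    by (auto simp: stable_set_vectors_def)
  ultimately have "principal_submatrix 0 I \<in> STAB2 H" for I and H :: "'a graph"
    unfolding STAB2_def by (intro hull_inc) auto
  moreover have "(0, 0) \<in> TH2 G"
    by (auto simp: TH2_def diag_vec_def psd_def outer_prod_def vec_eq_iff transpose_def
        matrix_vector_mult_def inner_vec_def)
  ultimately show ?thesis
    by (simp add: exact_feasible_def)
qed

lemma Greatest_objective_attained:
  fixes S :: "((real^'n) \<times> (real^'n^'n)) set"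
  assumes "compact S" "S \<noteq> {}"
  defines "m \<equiv> GREATEST t. \<exists>x X. (x, X) \<in> S \<and> t = 1 \<bullet> x"
  shows "\<exists>x X. (x, X) \<in> S \<and> m = 1 \<bullet> x" and "(x, X) \<in> S \<Longrightarrow> 1 \<bullet> x \<le> m"
proof -
  have "continuous_on S (\<lambda>p. 1 \<bullet> fst p)"
    by (intro continuous_intros)
  then obtain p where p: "p \<in> S" "\<forall>q\<in>S. 1 \<bullet> fst q \<le> 1 \<bullet> fst p"
    using continuous_attains_sup assms(1,2) by metis
  have ex: "\<exists>x X. (x, X) \<in> S \<and> 1 \<bullet> fst p = 1 \<bullet> x"
    using p(1) by (metis prod.collapse)
  have m: "m = 1 \<bullet> fst p"
    unfolding m_def using ex p(2) by (intro Greatest_equality) auto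
  show "\<exists>x X. (x, X) \<in> S \<and> m = 1 \<bullet> x"
    using ex m by simp
  show "(x, X) \<in> S \<Longrightarrow> 1 \<bullet> x \<le> m"
    using p(2) m by auto
qed

lemma theta_attained:
  shows "\<exists>x X. (x, X) \<in> TH2 G \<and> theta G = 1 \<bullet> x"
    and "(x, X) \<in> TH2 G \<Longrightarrow> 1 \<bullet> x \<le> theta G"
proof -
  have "TH2 G \<noteq> {}"
    using zero_in_exact_feasible[of 0 G] by (auto simp: exact_feasible_def)
  note * = Greatest_objective_attained[OF compact_TH2 this, folded theta_def]
  show "\<exists>x X. (x, X) \<in> TH2 G \<and> theta G = 1 \<bullet> x"
    and "(x, X) \<in> TH2 G \<Longrightarrow> 1 \<bullet> x \<le> theta G"
    by (fact *)+
qed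

lemma z_exact_attained:
  shows "\<exists>x X. (x, X) \<in> exact_feasible k G \<and> z_exact k G = 1 \<bullet> x"
    and "(x, X) \<in> exact_feasible k G \<Longrightarrow> 1 \<bullet> x \<le> z_exact k G"
proof -
  have "exact_feasible k G \<noteq> {}"
    using zero_in_exact_feasible[of k G] by auto
  note * = Greatest_objective_attained[OF compact_exact_feasible this, folded z_exact_def]
  show "\<exists>x X. (x, X) \<in> exact_feasible k G \<and> z_exact k G = 1 \<bullet> x"
    and "(x, X) \<in> exact_feasible k G \<Longrightarrow> 1 \<bullet> x \<le> z_exact k G"
    by (fact *)+
qed

end

theory Submission
  imports Defs
begin

text \<open>
  All levels maximise the same functional over subsets of the same body, so levels are compared
  by inclusion of their feasible sets. If \<open>I \<subseteq> J\<close>, cutting \<open>s s\<^sup>T\<close> down to the indices in \<open>I\<close>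
  gives \<open>t t\<^sup>T\<close> with \<open>t\<close> the restriction of \<open>s\<close>, and \<open>t\<close> is a stable set vector on \<open>I\<close> whenever
  \<open>s\<close> is one on \<open>J\<close>. As cutting down is linear, the exactness of the larger subgraph forces that
  of the smaller one (\<open>principal_submatrix_STAB2\<close>). Every set of \<open>j\<close> vertices extends to one of
  \<open>k \<ge> j\<close> vertices as long as \<open>k \<le> n\<close>, hence the feasible sets shrink as the level grows
  (\<open>exact_feasible_antimono\<close>).

  At the bottom, level 0 asks for nothing, and level 1 only asks for diagonal entries in
  \<open>[0, 1]\<close>, which positive semidefiniteness of \<open>X - x x\<^sup>T\<close> with \<open>diag X = x\<close> already gives. At the
  top, \<open>X\<close> itself is a convex combination of matrices \<open>s s\<^sup>T\<close>. The objective equals the trace of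
  \<open>X\<close>, and the trace of \<open>s s\<^sup>T\<close> is the size of the stable set described by \<open>s\<close>. So the value is at
  most \<open>\<alpha>(G)\<close>, and \<open>s s\<^sup>T\<close> for a maximum stable set attains it.
\<close>

definition restrict_vec :: "real^'n \<Rightarrow> 'n set \<Rightarrow> real^'n" where
  "restrict_vec s I = (\<chi> i. if i \<in> I then s $ i else 0)"

definition indicator_vec :: "'n set \<Rightarrow> real^'n" where
  "indicator_vec S = (\<chi> i. if i \<in> S then 1 else 0)"

lemma linear_principal_submatrix: "linear (\<lambda>X. principal_submatrix X I)"
  by (rule linearI) (auto simp: principal_submatrix_def vec_eq_iff)

lemma principal_submatrix_outer_prod:
  "principal_submatrix (outer_prod s s) I = outer_prod (restrict_vec s I) (restrict_vec s I)"
  by (auto simp: principal_submatrix_def outer_prod_def restrict_vec_def vec_eq_iff)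

lemma outer_prod_in_STAB2: "s \<in> stable_set_vectors H \<Longrightarrow> outer_prod s s \<in> STAB2 H"
  unfolding STAB2_def by (rule hull_inc) auto

lemma restrict_stable_set_vector:
  assumes "s \<in> stable_set_vectors (induced_subgraph G J)" and "I \<subseteq> J"
  shows "restrict_vec s I \<in> stable_set_vectors (induced_subgraph G I)"
  using assms by (force simp: stable_set_vectors_def induced_subgraph_def restrict_vec_def)

text \<open>
  The cut is linear, so it commutes with the convex hull and only has to be checked on the
  generating matrices.
\<close>

lemma principal_submatrix_STAB2:
  fixes G :: "'n::finite graph"
  assumes X: "X \<in> STAB2 (induced_subgraph G J)" and "I \<subseteq> J"
  shows "principal_submatrix X I \<in> STAB2 (induced_subgraph G I)"
proof -
  let ?gen = "\<lambda>H. {outer_prod s s | s. s \<in> stable_set_vectors (H :: 'n graph)}"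
  let ?cut = "\<lambda>X. principal_submatrix X I"
  have "?cut X \<in> ?cut ` (convex hull ?gen (induced_subgraph G J))"
    using X unfolding STAB2_def by blast
  also have "\<dots> = convex hull (?cut ` ?gen (induced_subgraph G J))"
    by (rule convex_hull_linear_image[OF linear_principal_submatrix])
  also have "\<dots> \<subseteq> convex hull ?gen (induced_subgraph G I)"
    using restrict_stable_set_vector[OF _ \<open>I \<subseteq> J\<close>]
    by (intro hull_mono) (force simp: principal_submatrix_outer_prod)
  finally show ?thesis
    by (simp add: STAB2_def)
qed

lemma exact_feasible_antimono:
  fixes G :: "'n::finite graph"
  assumes "j \<le> k" and "k \<le> card (verts G)"
  shows "exact_feasible k G \<subseteq> exact_feasible j G"
proof clarify
  fix x X assume X: "(x, X) \<in> exact_feasible k G"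
  have "principal_submatrix X I \<in> STAB2 (induced_subgraph G I)"
    if I: "I \<subseteq> verts G" "card I = j" for I
  proof -
    obtain J where J: "I \<subseteq> J" "J \<subseteq> verts G" "card J = k"
      using exists_subset_between[of I k "verts G"] I assms by auto
    have "principal_submatrix X J \<in> STAB2 (induced_subgraph G J)"
      using X J by (simp add: exact_feasible_def)
    then have "principal_submatrix (principal_submatrix X J) I \<in> STAB2 (induced_subgraph G I)"
      using J(1) by (rule principal_submatrix_STAB2)
    also have "principal_submatrix (principal_submatrix X J) I = principal_submatrix X I"
      using J(1) by (auto simp: principal_submatrix_def vec_eq_iff)
    finally show ?thesis .
  qed
  then show "(x, X) \<in> exact_feasible j G"
    using X by (simp add: exact_feasible_def)
qed

lemma z_exact_antimono:
  assumes "j \<le> k" and "k \<le> card (verts G)"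
  shows "z_exact k G \<le> z_exact j G"
proof -
  obtain x X where "(x, X) \<in> exact_feasible k G" and z: "z_exact k G = 1 \<bullet> x"
    using z_exact_attained(1) by blast
  then have "(x, X) \<in> exact_feasible j G"
    using exact_feasible_antimono[OF assms] by blast
  then show ?thesis
    unfolding z by (rule z_exact_attained(2))
qed

lemma exact_feasible_0: "exact_feasible 0 G = TH2 G"
proof -
  have "principal_submatrix X {} \<in> STAB2 (induced_subgraph G {})" for X
  proof -
    have "principal_submatrix 0 {} \<in> STAB2 (induced_subgraph G {})"
      using zero_in_exact_feasible[of 0 G] by (simp add: exact_feasible_def)
    then show ?thesis
      by (simp add: principal_submatrix_def)
  qed
  then show ?thesis
    by (auto simp: exact_feasible_def)
qed

text \<open>
  On a single vertex \<open>i\<close> the polytope is the segment between \<open>0\<close> and \<open>e\<^sub>i e\<^sub>i\<^sup>T\<close>.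
  Nonnegativity of the diagonal entry \<open>X\<^sub>i\<^sub>i - x\<^sub>i\<^sup>2 = x\<^sub>i - x\<^sub>i\<^sup>2\<close> places
  \<open>X\<^sub>i\<^sub>i\<close> on that segment.
\<close>

lemma exact_feasible_1:
  fixes G :: "'n::finite graph"
  assumes "simple_graph G"
  shows "exact_feasible 1 G = TH2 G"
proof -
  have "principal_submatrix X {i} \<in> STAB2 (induced_subgraph G {i})"
    if X: "(x, X) \<in> TH2 G" for x X i
  proof -
    have "diag_vec X = x" and psd: "psd (X - outer_prod x x)"
      using X by (auto simp: TH2_def)
    then have Xii: "X $ i $ i = x $ i"
      by (auto simp: diag_vec_def)
    have "0 \<le> x $ i - x $ i * x $ i"
      using psd_entry_bound(1)[OF psd, of i] by (simp add: outer_prod_def Xii)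
    then have x0: "0 \<le> x $ i"
      using zero_le_square[of "x $ i"] by linarith
    have x1: "x $ i \<le> 1"
      using TH2_entry_bounds(1)[OF X, of i] by simp
    let ?e = "indicator_vec {i}" and ?H = "induced_subgraph G {i}"
    have no_loop: "{i} \<notin> edges G"
      using assms by (force simp: simple_graph_def)
    have "(0 :: real^'n) \<in> stable_set_vectors ?H"
      by (auto simp: stable_set_vectors_def)
    moreover have "?e \<in> stable_set_vectors ?H"
      using no_loop by (auto simp: stable_set_vectors_def induced_subgraph_def indicator_vec_def)
    ultimately have "(1 - x $ i) *\<^sub>R outer_prod 0 0 + x $ i *\<^sub>R outer_prod ?e ?e \<in> STAB2 ?H"
      using x0 x1 by (intro convexD outer_prod_in_STAB2) (auto simp: STAB2_def)
    also have "(1 - x $ i) *\<^sub>R outer_prod 0 0 + x $ i *\<^sub>R outer_prod ?e ?e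
        = principal_submatrix X {i}"
      by (auto simp: vec_eq_iff principal_submatrix_def outer_prod_def indicator_vec_def Xii)
    finally show ?thesis .
  qed
  then show ?thesis
    by (auto simp: exact_feasible_def card_1_singleton_iff)
qed

lemma stable_set_indicator_vec:
  assumes "stable_set G S"
  shows "indicator_vec S \<in> stable_set_vectors G"
  using assms by (auto simp: stable_set_def stable_set_vectors_def indicator_vec_def)

lemma stable_set_vector_support:
  assumes "s \<in> stable_set_vectors G"
  obtains S where "stable_set G S" and "s = indicator_vec S"
proof
  let ?S = "{i \<in> verts G. s $ i = 1}"
  show "stable_set G ?S"
    using assms by (force simp: stable_set_def stable_set_vectors_def)
  show "s = indicator_vec ?S"
    using assms by (auto simp: vec_eq_iff stable_set_vectors_def indicator_vec_def)
qed

lemma inner_one_indicator_vec: "1 \<bullet> indicator_vec S = real (card S)"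
  by (simp add: inner_vec_def indicator_vec_def sum.If_cases)

lemma trace_outer_prod_indicator_vec:
  "trace (outer_prod (indicator_vec S) (indicator_vec S)) = real (card S)"
proof -
  have "trace (outer_prod (indicator_vec S) (indicator_vec S)) = 1 \<bullet> indicator_vec S"
    by (auto simp: trace_def inner_vec_def outer_prod_def indicator_vec_def intro: sum.cong)
  then show ?thesis
    by (simp add: inner_one_indicator_vec)
qed

lemma card_le_stability_number:
  fixes G :: "'n::finite graph"
  shows "stable_set G S \<Longrightarrow> card S \<le> stability_number G"
  unfolding stability_number_def by (rule Max_ge) auto

lemma maximum_stable_set:
  fixes G :: "'n::finite graph"
  obtains S where "stable_set G S" and "card S = stability_number G"
proof -
  have "stable_set G {}"
    by (simp add: stable_set_def)
  then have "stability_number G \<in> card ` {S. stable_set G S}"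
    unfolding stability_number_def by (intro Max_in) auto
  then show ?thesis
    using that by auto
qed

lemma trace_STAB2_le:
  fixes G :: "'n::finite graph"
  assumes "X \<in> STAB2 G"
  shows "trace X \<le> real (stability_number G)"
proof -
  have lin: "linear (trace :: real^'n^'n \<Rightarrow> real)"
    by (rule linearI) (auto simp: trace_def sum.distrib sum_distrib_left)
  have "convex ((trace :: real^'n^'n \<Rightarrow> real) -` {..real (stability_number G)})"
    using lin by (rule convex_linear_vimage) simp
  moreover have "{outer_prod s s | s. s \<in> stable_set_vectors G}
      \<subseteq> trace -` {..real (stability_number G)}"
    using card_le_stability_number[of G]
    by (auto simp: trace_outer_prod_indicator_vec elim!: stable_set_vector_support)
  ultimately show ?thesis
    using assms hull_minimal unfolding STAB2_def by blast
qed

text \<open>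
  The matrix \<open>s s\<^sup>T\<close> of a stable set satisfies the constraints of every level, since
  \<open>X - x x\<^sup>T\<close> vanishes and all its principal submatrices are generators of their polytopes.
\<close>

lemma stable_set_exact_feasible:
  fixes G :: "'n::finite graph"
  assumes "verts G = UNIV" and "stable_set G S"
  defines "s \<equiv> indicator_vec S"
  shows "(s, outer_prod s s) \<in> exact_feasible k G"
proof -
  have s: "s \<in> stable_set_vectors G"
    unfolding s_def using assms(2) by (rule stable_set_indicator_vec)
  have "diag_vec (outer_prod s s) = s"
    by (simp add: diag_vec_def outer_prod_def s_def indicator_vec_def vec_eq_iff)
  moreover have "transpose (outer_prod s s) = outer_prod s s"
    by (simp add: transpose_def outer_prod_def vec_eq_iff mult.commute)
  moreover have "outer_prod s s $ i $ j = 0" if "{i, j} \<in> edges G" for i j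
    using s that by (simp add: stable_set_vectors_def outer_prod_def)
  moreover have "psd (outer_prod s s - outer_prod s s)"
    by (simp add: psd_def transpose_def vec_eq_iff)
  ultimately have "(s, outer_prod s s) \<in> TH2 G"
    by (simp add: TH2_def)
  moreover have "principal_submatrix (outer_prod s s) I \<in> STAB2 (induced_subgraph G I)" for I
  proof -
    have "s \<in> stable_set_vectors (induced_subgraph G UNIV)"
      using s assms(1) by (simp add: stable_set_vectors_def induced_subgraph_def)
    then show ?thesis
      using outer_prod_in_STAB2 by (intro principal_submatrix_STAB2[where J = UNIV]) auto
  qed
  ultimately show ?thesis
    by (simp add: exact_feasible_def)
qed

lemma stability_number_le_z_exact:
  assumes "verts G = UNIV"
  shows "real (stability_number G) \<le> z_exact k G"
proof -
  obtain S where S: "stable_set G S" "card S = stability_number G"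
    by (rule maximum_stable_set)
  show ?thesis
    using z_exact_attained(2)[OF stable_set_exact_feasible[OF assms S(1)]]
    by (simp add: inner_one_indicator_vec S(2))
qed

text \<open>
  The only index set with \<open>n\<close> elements is the whole vertex set, so the top level requires \<open>X\<close>
  itself to lie in the squared stable set polytope of \<open>G\<close>.
\<close>

lemma z_exact_top_le_stability_number:
  fixes G :: "'n::finite graph"
  assumes "verts G = UNIV"
  shows "z_exact (card (verts G)) G \<le> real (stability_number G)"
proof -
  obtain x X where X: "(x, X) \<in> exact_feasible (card (verts G)) G"
    and z: "z_exact (card (verts G)) G = 1 \<bullet> x"
    using z_exact_attained(1) by blast
  have "principal_submatrix X UNIV \<in> STAB2 (induced_subgraph G UNIV)"
    using X assms by (simp add: exact_feasible_def)
  moreover have "principal_submatrix X UNIV = X"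
    by (simp add: principal_submatrix_def vec_eq_iff)
  moreover have "STAB2 (induced_subgraph G UNIV) = STAB2 G"
    using assms by (simp add: STAB2_def stable_set_vectors_def induced_subgraph_def)
  ultimately have "trace X \<le> real (stability_number G)"
    using trace_STAB2_le by simp
  moreover have "1 \<bullet> x = trace X"
    using X by (auto simp: exact_feasible_def TH2_def diag_vec_def trace_def inner_vec_def)
  ultimately show ?thesis
    using z by simp
qed

theorem lemma2:
  fixes G :: "'n::finite graph" and n k :: nat
  assumes "simple_graph G" and "verts G = UNIV" and "card (verts G) = n"
    and "k \<in> {1..n}"
  shows "theta G = z_exact 0 G \<and> z_exact 0 G = z_exact 1 G \<and>
    z_exact 1 G \<ge> z_exact (k - 1) G \<and> z_exact (k - 1) G \<ge> z_exact k G \<and>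
    z_exact k G \<ge> z_exact n G \<and> z_exact n G = real (stability_number G)"
proof (intro conjI)
  show "theta G = z_exact 0 G"
    by (simp add: theta_def z_exact_def exact_feasible_0)
  show z01: "z_exact 0 G = z_exact 1 G"
    using exact_feasible_1[OF assms(1)] by (simp add: z_exact_def exact_feasible_0)
  \<comment> \<open>For \<open>k = 1\<close> level 1 is compared with the weaker level 0, where monotonicity gives only the
    opposite inequality; hence level 1 is replaced by level 0.\<close>
  show "z_exact 1 G \<ge> z_exact (k - 1) G"
    unfolding z01[symmetric] using assms(3,4) by (intro z_exact_antimono) auto
  show "z_exact (k - 1) G \<ge> z_exact k G"
    using assms(3,4) by (intro z_exact_antimono) auto
  show "z_exact k G \<ge> z_exact n G"
    using assms(3,4) by (intro z_exact_antimono) auto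
  show "z_exact n G = real (stability_number G)"
    using z_exact_top_le_stability_number[OF assms(2)] stability_number_le_z_exact[OF assms(2)]
      assms(3) by (simp add: order_antisym)
qed

end
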